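(* For every $n\ge 1$, $$\sum_{\sigma\in B_n} (-1)^{\mathrm{neg}(\sigma)} q^{\mathrm{fmaj}(\sigma)} = [2]_{-q}[4]_{-q}\cdots[2n]_{-q}.$$
   Context: $B_n$ is the group of signed permutations of $[n]$. $[n]_q=(1-q^n)/(1-q)$. $\mathrm{neg}(\sigma)=\#\{i:\sigma(i)<0\}$; $\mathrm{fmaj}(\sigma)=2\,\mathrm{maj}(\sigma)+\mathrm{neg}(\sigma)$ with $\mathrm{maj}$ the major index of $(\sigma(1),\dots,\sigma(n))$ with respect to the order $-1<\cdots<-n<1<\cdots<n$. *)

theory Defs
  imports
    "HOL-Computational_Algebra.Polynomial"
    "HOL-Combinatorics.Permutations"
begin

definition signed_perms :: "nat \<Rightarrow> (int \<Rightarrow> int) set" where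
  "signed_perms n =
     {\<sigma>. \<sigma> permutes ({- int n..int n} - {0}) \<and> (\<forall>i. \<sigma> (- i) = - \<sigma> i)}"

lemma finite_signed_perms: "finite (signed_perms n)"
  by (rule finite_subset[OF _ finite_permutations[of "{- int n..int n} - {0}"]])
     (auto simp: signed_perms_def)

text \<open>The strict order \<open>-1 < -2 < \<dots> < -n < 1 < 2 < \<dots> < n\<close> on the nonzero integers.\<close>

definition sgn_less :: "int \<Rightarrow> int \<Rightarrow> bool" where
  "sgn_less a b \<longleftrightarrow> a < 0 \<and> 0 < b \<or> sgn a = sgn b \<and> \<bar>a\<bar> < \<bar>b\<bar>"

definition neg :: "nat \<Rightarrow> (int \<Rightarrow> int) \<Rightarrow> nat" where
  "neg n \<sigma> = card {i \<in> {1..n}. \<sigma> (int i) < 0}"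

definition maj :: "nat \<Rightarrow> (int \<Rightarrow> int) \<Rightarrow> nat" where
  "maj n \<sigma> = \<Sum>{i \<in> {1..<n}. sgn_less (\<sigma> (int (i + 1))) (\<sigma> (int i))}"

definition fmaj :: "nat \<Rightarrow> (int \<Rightarrow> int) \<Rightarrow> nat" where
  "fmaj n \<sigma> = 2 * maj n \<sigma> + neg n \<sigma>"

text \<open>In a polynomial ring \<open>div\<close> is exact division whenever the divisor divides the
  dividend; \<open>1 - x\<close> always divides \<open>1 - x ^ m\<close>, as \<open>q_int_eq_sum\<close> confirms.\<close>

definition q_int :: "'a::idom_divide \<Rightarrow> nat \<Rightarrow> 'a" where
  "q_int x m = (1 - x ^ m) div (1 - x)"

lemma q_int_eq_sum: "x \<noteq> 1 \<Longrightarrow> q_int x m = (\<Sum>i<m. x ^ i)"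
  by (simp add: q_int_def one_diff_power_eq)

end

theory Submission imports Defs begin

text \<open>
  Since \<open>fmaj\<close> and \<open>neg\<close> have the same parity, the sum is the generating function of \<open>fmaj\<close> at
  \<open>-q\<close>. Let \<open>\<delta>\<close> be the cyclic shift of the letters
  \<open>n \<rightarrow> n - 1 \<rightarrow> \<dots> \<rightarrow> 1 \<rightarrow> -n \<rightarrow> \<dots> \<rightarrow> -1 \<rightarrow> n\<close>, that is, one step down in the order defining \<open>maj\<close>.
  Composing \<open>\<sigma>\<close> with \<open>\<delta>\<close> raises \<open>fmaj\<close> by exactly 1 unless the last letter is \<open>-1\<close>: the letter 1
  becomes negative without changing a descent, whereas the minimum \<open>-1\<close> in position \<open>p < n\<close> becomes
  the maximum, which moves a descent from \<open>p - 1\<close> to \<open>p\<close> and removes a negative letter. Every orbit has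
  \<open>2n\<close> elements, told apart by their last letters, and exactly one of them ends in \<open>n\<close>, i.e. belongs
  to \<open>B\<close> of rank \<open>n - 1\<close>, with the same \<open>fmaj\<close>. Each rank therefore contributes the factor
  \<open>1 + x + \<dots> + x ^ (2n - 1)\<close>.
\<close>

definition letter_shift :: "nat \<Rightarrow> int \<Rightarrow> int" where
  "letter_shift n x =
     (if x = 1 then - int n else if x = -1 then int n
      else if 2 \<le> x \<and> x \<le> int n then x - 1
      else if - int n \<le> x \<and> x \<le> -2 then x + 1 else x)"

section \<open>Signed permutations: closure and the inclusion of consecutive ranks\<close>

lemma id_in_signed_perms: "id \<in> signed_perms n"
  by (simp add: signed_perms_def permutes_id)

lemma comp_in_signed_perms:
  "\<sigma> \<in> signed_perms n \<Longrightarrow> \<tau> \<in> signed_perms n \<Longrightarrow> \<sigma> \<circ> \<tau> \<in> signed_perms n"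
  by (auto simp: signed_perms_def intro: permutes_compose)

lemma funpow_in_signed_perms: "\<sigma> \<in> signed_perms n \<Longrightarrow> \<sigma> ^^ k \<in> signed_perms n"
  by (induction k) (simp_all add: id_in_signed_perms[unfolded id_def] comp_in_signed_perms id_def)

lemma inv_in_signed_perms:
  assumes "\<sigma> \<in> signed_perms n"
  shows "inv \<sigma> \<in> signed_perms n"
proof -
  have p: "\<sigma> permutes ({- int n..int n} - {0})" and odd: "\<And>i. \<sigma> (- i) = - \<sigma> i"
    using assms by (auto simp: signed_perms_def)
  have "inv \<sigma> (- i) = - inv \<sigma> i" for i
    by (metis odd p permutes_inverses)
  then show ?thesis
    using p by (simp add: signed_perms_def permutes_inv)
qed

lemma signed_perms_inj: "\<sigma> \<in> signed_perms n \<Longrightarrow> inj \<sigma>"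
  by (auto simp: signed_perms_def intro: permutes_inj)

lemma signed_perms_mem:
  assumes "\<sigma> \<in> signed_perms n" "x \<noteq> 0" "\<bar>x\<bar> \<le> int n"
  shows "\<sigma> x \<noteq> 0" "\<bar>\<sigma> x\<bar> \<le> int n"
proof -
  have "x \<in> {- int n..int n} - {0}"
    using assms by auto
  then have "\<sigma> x \<in> {- int n..int n} - {0}"
    using assms(1) by (simp only: signed_perms_def mem_Collect_eq permutes_in_image)
  then show "\<sigma> x \<noteq> 0" "\<bar>\<sigma> x\<bar> \<le> int n"
    by auto
qed

text \<open>Signed permutations act on all integers and are the identity outside their alphabet, so
  the lower group is literally a subset of the higher one. For the converse, oddness turns the fixed
  letter \<open>m + 1\<close> into a second fixed letter \<open>- (m + 1)\<close>, and the support
  shrinks.\<close>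

lemma signed_perms_fix_iff:
  "\<sigma> \<in> signed_perms m \<longleftrightarrow> \<sigma> \<in> signed_perms (Suc m) \<and> \<sigma> (int (Suc m)) = int (Suc m)"
  (is "?L \<longleftrightarrow> ?R")
proof
  assume ?L
  then show ?R
    by (auto simp: signed_perms_def permutes_not_in elim: permutes_subset)
next
  assume R: ?R
  have "\<sigma> (- int (Suc m)) = - int (Suc m)"
    using R by (simp only: signed_perms_def mem_Collect_eq)
  then have "\<sigma> x = x" if "x \<in> ({- int (Suc m)..int (Suc m)} - {0}) - ({- int m..int m} - {0})" for x
    using R that by (cases "x = int (Suc m)"; cases "x = - int (Suc m)") auto
  moreover have "\<sigma> permutes ({- int (Suc m)..int (Suc m)} - {0})"
    using R by (simp only: signed_perms_def mem_Collect_eq)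
  ultimately have "\<sigma> permutes ({- int m..int m} - {0})"
    by (metis permutes_superset)
  then show ?L
    using R by (simp add: signed_perms_def)
qed

section \<open>The cyclic shift as a signed permutation\<close>

lemma letter_shift_in_signed_perms:
  assumes "n \<ge> 1"
  shows "letter_shift n \<in> signed_perms n"
proof -
  let ?S = "{- int n..int n} - {0}"
  have "inj_on (letter_shift n) ?S"
    by (auto simp: inj_on_def letter_shift_def split: if_splits)
  moreover have "letter_shift n ` ?S \<subseteq> ?S"
    using assms by (auto simp: letter_shift_def)
  ultimately have "bij_betw (letter_shift n) ?S ?S"
    by (simp add: bij_betw_def endo_inj_surj)
  moreover have "letter_shift n x = x" if "x \<notin> ?S" for x
    using that assms by (auto simp: letter_shift_def)
  ultimately have "letter_shift n permutes ?S"
    by (rule bij_imp_permutes)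
  moreover have "letter_shift n (- x) = - letter_shift n x" for x
    by (auto simp: letter_shift_def)
  ultimately show ?thesis
    by (simp add: signed_perms_def)
qed

text \<open>The orbit of the maximum \<open>n\<close> runs through n, ..., 1 and then -n, ..., -1.
  Hence the exponent can be read off from the letter reached, and \<open>-1\<close> appears only at
  \<open>k = 2 * n - 1\<close>.\<close>

lemma letter_shift_funpow_top:
  "k < 2 * n \<Longrightarrow> (letter_shift n ^^ k) (int n) = (if k < n then int n - int k else int k - 2 * int n)"
  by (induction k) (auto simp: letter_shift_def)

text \<open>Every letter but the minimum \<open>-1\<close> moves one step down a linear order, so
  all comparisons among these letters survive.\<close>

lemma sgn_less_letter_shift:
  assumes "a \<noteq> 0" "\<bar>a\<bar> \<le> int n" "a \<noteq> -1" "b \<noteq> 0" "\<bar>b\<bar> \<le> int n" "b \<noteq> -1"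
  shows "sgn_less (letter_shift n a) (letter_shift n b) \<longleftrightarrow> sgn_less a b"
  using assms
  by (cases "a = 1"; cases "b = 1"; cases "a < 0"; cases "b < 0")
    (simp_all add: sgn_less_def letter_shift_def sgn_if)

lemma letter_shift_neg_iff:
  assumes "n \<ge> 1" "a \<noteq> 0" "\<bar>a\<bar> \<le> int n"
  shows "letter_shift n a < 0 \<longleftrightarrow> a = 1 \<or> a < 0 \<and> a \<noteq> -1"
  using assms by (auto simp: letter_shift_def)

section \<open>One shift raises the flag major index by one\<close>

lemma fmaj_letter_shift:
  assumes \<sigma>: "\<sigma> \<in> signed_perms n" and n: "n \<ge> 1" and last: "\<sigma> (int n) \<noteq> -1"
  shows "fmaj n (letter_shift n \<circ> \<sigma>) = Suc (fmaj n \<sigma>)"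
proof -
  let ?\<tau> = "letter_shift n \<circ> \<sigma>"
  define D where "D = {i \<in> {1..<n}. sgn_less (\<sigma> (int (i + 1))) (\<sigma> (int i))}"
  define D' where "D' = {i \<in> {1..<n}. sgn_less (?\<tau> (int (i + 1))) (?\<tau> (int i))}"
  define N where "N = {i \<in> {1..n}. \<sigma> (int i) < 0}"
  have fin: "finite D" "finite N"
    by (auto simp: D_def N_def)
  have mem: "\<sigma> (int i) \<noteq> 0" "\<bar>\<sigma> (int i)\<bar> \<le> int n" if "1 \<le> i" "i \<le> n" for i
    using signed_perms_mem[OF \<sigma>, of "int i"] that by auto
  have eq_iff: "\<sigma> x = \<sigma> y \<longleftrightarrow> x = y" for x y
    using signed_perms_inj[OF \<sigma>] by (simp add: inj_eq)
  have odd: "\<sigma> (- x) = - \<sigma> x" for x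
    using \<sigma> by (simp add: signed_perms_def)
  have surj: "surj \<sigma>"
    using \<sigma> by (metis (lifting) signed_perms_def mem_Collect_eq permutes_surj)
  then obtain x where x: "\<sigma> x = 1"
    by (metis surjD)
  have "x \<in> {- int n..int n} - {0}"
  proof (rule ccontr)
    assume out: "x \<notin> {- int n..int n} - {0}"
    then have "\<sigma> x = x"
      using \<sigma> by (metis (lifting) signed_perms_def mem_Collect_eq permutes_not_in)
    with out x n show False by auto
  qed
  then have xr: "1 \<le> nat \<bar>x\<bar>" "nat \<bar>x\<bar> \<le> n"
    by auto
  \<comment> \<open>The position of the only letter of absolute value 1, the only letter whose sign
    the shift changes.\<close>
  define p where "p = nat \<bar>x\<bar>"
  have p: "1 \<le> p" "p \<le> n"
    using xr by (simp_all add: p_def)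
  have "\<sigma> (int p) = 1 \<or> \<sigma> (int p) = -1"
    using x odd[of x] by (cases "x \<ge> 0") (auto simp: p_def)
  then show ?thesis
  proof
    \<comment> \<open>Here \<open>-1\<close> is absent, so the descents stay and \<open>neg\<close>
      grows by 1.\<close>
    assume 1: "\<sigma> (int p) = 1"
    have no: "\<sigma> (int i) \<noteq> -1" for i
    proof
      assume "\<sigma> (int i) = -1"
      then have "\<sigma> (- int i) = \<sigma> (int p)"
        using 1 odd[of "int i"] by simp
      then show False
        using p by (simp add: eq_iff)
    qed
    have "D' = D"
    proof (intro set_eqI)
      fix i
      show "i \<in> D' \<longleftrightarrow> i \<in> D"
        using sgn_less_letter_shift[of "\<sigma> (int (i + 1))" n "\<sigma> (int i)"]
          mem[of i] mem[of "i + 1"] no[of i] no[of "i + 1"]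
        by (auto simp: D_def D'_def simp del: of_nat_add)
    qed
    then have maj: "maj n ?\<tau> = maj n \<sigma>"
      by (simp add: maj_def D_def D'_def)
    have "{i \<in> {1..n}. ?\<tau> (int i) < 0} = insert p N"
    proof (intro set_eqI)
      fix i
      show "i \<in> {i \<in> {1..n}. ?\<tau> (int i) < 0} \<longleftrightarrow> i \<in> insert p N"
        using letter_shift_neg_iff[OF n mem, of i] p no[of i] 1 eq_iff[of "int i" "int p"]
        by (auto simp: N_def)
    qed
    moreover have "p \<notin> N"
      using 1 by (simp add: N_def)
    ultimately have "neg n ?\<tau> = Suc (neg n \<sigma>)"
      using fin by (simp add: neg_def N_def)
    then show ?thesis
      by (simp add: fmaj_def maj)
  next
    \<comment> \<open>Here \<open>maj\<close> grows by 1 and \<open>neg\<close> drops by 1, a net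
      change of 2 - 1 = 1 in \<open>fmaj\<close>.\<close>
    assume 1: "\<sigma> (int p) = -1"
    with last p have pn: "p < n"
      by (cases "p = n") auto
    have no: "\<sigma> (int i) \<noteq> 1" for i
    proof
      assume "\<sigma> (int i) = 1"
      then have "\<sigma> (- int i) = \<sigma> (int p)"
        using 1 odd[of "int i"] by simp
      then show False
        using p by (simp add: eq_iff)
    qed
    have m1: "\<sigma> (int i) = -1 \<longleftrightarrow> i = p" for i
      using 1 eq_iff[of "int i" "int p"] by auto
    have top: "letter_shift n a = int n \<longleftrightarrow> a = -1" if "a \<noteq> 0" "\<bar>a\<bar> \<le> int n" for a
      using that n by (auto simp: letter_shift_def)
    have bnd: "letter_shift n a \<noteq> 0" "\<bar>letter_shift n a\<bar> \<le> int n" if "a \<noteq> 0" "\<bar>a\<bar> \<le> int n" for a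
      using that n by (auto simp: letter_shift_def)
    have max: "sgn_less b (int n)" "\<not> sgn_less (int n) b" if "b \<noteq> 0" "\<bar>b\<bar> \<le> int n" "b \<noteq> int n" for b
      using that by (auto simp: sgn_less_def sgn_if)
    have min: "sgn_less (-1) b" "\<not> sgn_less b (-1)" if "b \<noteq> 0" "b \<noteq> -1" for b
      using that by (auto simp: sgn_less_def sgn_if)
    have pD: "p \<notin> D"
      using min(2)[of "\<sigma> (int (p + 1))"] mem[of "p + 1"] m1[of "p + 1"] 1 pn by (auto simp: D_def)
    have "D' = insert p (D - {p - 1})"
    proof (intro set_eqI)
      fix i
      show "i \<in> D' \<longleftrightarrow> i \<in> insert p (D - {p - 1})"
      proof (cases "1 \<le> i \<and> i < n")
        case True
        let ?a = "\<sigma> (int i)" and ?b = "\<sigma> (int (i + 1))"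
        have a: "?a \<noteq> 0" "\<bar>?a\<bar> \<le> int n" and b: "?b \<noteq> 0" "\<bar>?b\<bar> \<le> int n"
          using mem[of i] mem[of "i + 1"] True by auto
        have iff: "i \<in> D' \<longleftrightarrow> sgn_less (letter_shift n ?b) (letter_shift n ?a)"
          "i \<in> D \<longleftrightarrow> sgn_less ?b ?a"
          using True by (auto simp: D_def D'_def)
        \<comment> \<open>The pair at \<open>p\<close> starts with the old minimum and new maximum,
          the pair at \<open>p - 1\<close> ends with it, and any other pair avoids \<open>-1\<close>
          and keeps its order.\<close>
        consider "i = p" | "i = p - 1" "i + 1 = p" | "i \<noteq> p" "i + 1 \<noteq> p"
          by fastforce
        then show ?thesis
        proof cases
          assume "i = p"
          moreover from this have "?a = -1" "?b \<noteq> -1"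
            using m1[of i] m1[of "i + 1"] by auto
          ultimately show ?thesis
            using iff top[OF a] top[OF b] max(1)[OF bnd[OF b]] by simp
        next
          assume i: "i = p - 1" "i + 1 = p"
          then have "?b = -1" "?a \<noteq> -1"
            using m1[of i] m1[of "i + 1"] by auto
          then show ?thesis
            using i iff top[OF a] top[OF b] max(2)[OF bnd[OF a]] by simp
        next
          assume i: "i \<noteq> p" "i + 1 \<noteq> p"
          then have "?b \<noteq> -1" "?a \<noteq> -1" "i \<noteq> p - 1"
            using m1[of i] m1[of "i + 1"] True by auto
          then show ?thesis
            using i iff a b by (simp add: sgn_less_letter_shift del: of_nat_add)
        qed
      next
        case False
        then show ?thesis
          using p pn by (auto simp: D_def D'_def)
      qed
    qed
    then have "maj n ?\<tau> = p + \<Sum>(D - {p - 1})"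
      using pD fin by (simp add: maj_def D'_def)
    also have "\<dots> = Suc (\<Sum>D)"
    \<comment> \<open>For \<open>p = 1\<close> there is no descent to give up, since position 0 is
      not in \<open>D\<close>; the new descent at 1 alone accounts for the increase.\<close>
    proof (cases "p = 1")
      case True
      then have "D - {p - 1} = D"
        by (auto simp: D_def)
      with True show ?thesis by simp
    next
      case False
      then have "1 \<le> p - 1" "p - 1 < n"
        using p pn by auto
      then have "p - 1 \<in> D"
        using 1 mem[of "p - 1"] m1[of "p - 1"] min(1)[of "\<sigma> (int (p - 1))"]
        by (simp add: D_def)
      then have "\<Sum>D = (p - 1) + \<Sum>(D - {p - 1})"
        using fin by (simp add: sum.remove)
      then show ?thesis
        using p by simp
    qed
    finally have maj: "maj n ?\<tau> = Suc (maj n \<sigma>)"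
      by (simp add: maj_def D_def)
    have "{i \<in> {1..n}. ?\<tau> (int i) < 0} = N - {p}"
    proof (intro set_eqI)
      fix i
      show "i \<in> {i \<in> {1..n}. ?\<tau> (int i) < 0} \<longleftrightarrow> i \<in> N - {p}"
        using letter_shift_neg_iff[OF n mem, of i] p no[of i] m1[of i]
        by (auto simp: N_def)
    qed
    moreover have "p \<in> N"
      using 1 p by (simp add: N_def)
    ultimately have "neg n \<sigma> = Suc (neg n ?\<tau>)"
      using fin card.remove[of N p] by (simp add: neg_def N_def)
    then show ?thesis
      by (simp add: fmaj_def maj)
  qed
qed

lemma fmaj_letter_shift_funpow:
  assumes \<sigma>: "\<sigma> \<in> signed_perms n" and top: "\<sigma> (int n) = int n" and k: "k < 2 * n"
  shows "fmaj n (letter_shift n ^^ k \<circ> \<sigma>) = fmaj n \<sigma> + k"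
  using k
proof (induction k)
  case (Suc k)
  let ?\<tau> = "letter_shift n ^^ k \<circ> \<sigma>"
  have n: "n \<ge> 1"
    using Suc.prems by simp
  have "?\<tau> \<in> signed_perms n"
    using \<sigma> n by (intro comp_in_signed_perms funpow_in_signed_perms letter_shift_in_signed_perms)
  \<comment> \<open>As \<open>k + 1 < 2 * n\<close>, the last letter has not yet come down to
    \<open>-1\<close>.\<close>
  moreover have "?\<tau> (int n) \<noteq> -1"
    using Suc.prems by (simp add: top letter_shift_funpow_top)
  ultimately have "fmaj n (letter_shift n \<circ> ?\<tau>) = Suc (fmaj n ?\<tau>)"
    using n by (intro fmaj_letter_shift)
  then show ?case
    using Suc by (simp add: comp_def)
qed simp

section \<open>Passage from rank m to rank m + 1\<close>

lemma fmaj_Suc: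
  assumes \<sigma>: "\<sigma> \<in> signed_perms m"
  shows "fmaj (Suc m) \<sigma> = fmaj m \<sigma>"
proof -
  have top: "\<sigma> (int (Suc m)) = int (Suc m)"
    using \<sigma> signed_perms_fix_iff by blast
  have "{i \<in> {1..Suc m}. \<sigma> (int i) < 0} = {i \<in> {1..m}. \<sigma> (int i) < 0}"
    using top by (auto simp: le_Suc_eq)
  \<comment> \<open>The appended letter is the maximum, so no descent arises before it.\<close>
  moreover have "\<not> sgn_less (\<sigma> (int (m + 1))) (\<sigma> (int m))" if "m \<ge> 1"
    using signed_perms_mem[OF \<sigma>, of "int m"] that top by (auto simp: sgn_less_def sgn_if)
  then have "{i \<in> {1..<Suc m}. sgn_less (\<sigma> (int (i + 1))) (\<sigma> (int i))} =
      {i \<in> {1..<m}. sgn_less (\<sigma> (int (i + 1))) (\<sigma> (int i))}"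
    by (auto simp: less_Suc_eq)
  ultimately show ?thesis
    by (simp only: fmaj_def maj_def neg_def)
qed

text \<open>The last letter of an element determines how many shifts lead to it from an element
  ending in \<open>n\<close>; undoing them recovers that element.\<close>

lemma bij_betw_letter_shift_funpow:
  fixes m :: nat
  defines "n \<equiv> Suc m"
  shows "bij_betw (\<lambda>(\<sigma>, k). letter_shift n ^^ k \<circ> \<sigma>) (signed_perms m \<times> {..<2 * n}) (signed_perms n)"
proof -
  have sp: "letter_shift n ^^ k \<in> signed_perms n" for k
    by (intro funpow_in_signed_perms letter_shift_in_signed_perms) (simp add: n_def)
  have fix_iff: "\<sigma> \<in> signed_perms m \<longleftrightarrow> \<sigma> \<in> signed_perms n \<and> \<sigma> (int n) = int n" for \<sigma>
    unfolding n_def by (rule signed_perms_fix_iff)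
  show ?thesis
    unfolding bij_betw_def
  proof (intro conjI subset_antisym subsetI)
    show "inj_on (\<lambda>(\<sigma>, k). letter_shift n ^^ k \<circ> \<sigma>) (signed_perms m \<times> {..<2 * n})"
    proof (rule inj_onI, clarsimp)
      fix \<sigma> k \<sigma>' k'
      assume \<sigma>: "\<sigma> \<in> signed_perms m" "\<sigma>' \<in> signed_perms m" and k: "k < 2 * n" "k' < 2 * n"
        and eq: "letter_shift n ^^ k \<circ> \<sigma> = letter_shift n ^^ k' \<circ> \<sigma>'"
      have "(letter_shift n ^^ k) (int n) = (letter_shift n ^^ k') (int n)"
        using fun_cong[OF eq, of "int n"] \<sigma> by (simp add: fix_iff)
      then have "k = k'"
        using k by (auto simp: letter_shift_funpow_top split: if_splits)
      with eq signed_perms_inj[OF sp[of k]] show "\<sigma> = \<sigma>' \<and> k = k'"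
        by (auto simp: fun_eq_iff inj_eq)
    qed
  next
    fix \<tau> assume "\<tau> \<in> (\<lambda>(\<sigma>, k). letter_shift n ^^ k \<circ> \<sigma>) ` (signed_perms m \<times> {..<2 * n})"
    then show "\<tau> \<in> signed_perms n"
      using sp by (auto simp: fix_iff intro: comp_in_signed_perms)
  next
    fix \<tau> assume \<tau>: "\<tau> \<in> signed_perms n"
    define y where "y = \<tau> (int n)"
    \<comment> \<open>This inverts the formula of \<open>letter_shift_funpow_top\<close>.\<close>
    define k where "k = nat (if y > 0 then int n - y else 2 * int n + y)"
    have "y \<noteq> 0" "\<bar>y\<bar> \<le> int n"
      using signed_perms_mem[OF \<tau>, of "int n"] by (auto simp: y_def n_def)
    then have k: "k < 2 * n" "(letter_shift n ^^ k) (int n) = y"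
      by (auto simp: k_def letter_shift_funpow_top)
    let ?\<sigma> = "inv (letter_shift n ^^ k) \<circ> \<tau>"
    have perm: "letter_shift n ^^ k permutes ({- int n..int n} - {0})"
      using sp[of k] by (simp add: signed_perms_def)
    have "?\<sigma> (int n) = int n"
      using k(2) permutes_inverses(2)[OF perm, of "int n"] by (simp add: y_def)
    then have "?\<sigma> \<in> signed_perms m"
      using \<tau> sp by (auto simp: fix_iff intro: comp_in_signed_perms inv_in_signed_perms)
    moreover have "letter_shift n ^^ k \<circ> ?\<sigma> = \<tau>"
      by (simp add: o_assoc permutes_inv_o(1)[OF perm])
    ultimately show "\<tau> \<in> (\<lambda>(\<sigma>, k). letter_shift n ^^ k \<circ> \<sigma>) ` (signed_perms m \<times> {..<2 * n})"
      using k(1) by (intro image_eqI[of _ _ "(?\<sigma>, k)"]) auto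
  qed
qed

text \<open>The variable is kept general so that \<open>- q\<close> can be substituted for
  it.\<close>

lemma sum_power_fmaj:
  fixes x :: "'a::comm_semiring_1"
  shows "(\<Sum>\<sigma>\<in>signed_perms n. x ^ fmaj n \<sigma>) = (\<Prod>i=1..n. \<Sum>j<2 * i. x ^ j)"
proof (induction n)
  case 0
  have "signed_perms 0 = {id}"
    by (auto simp: signed_perms_def)
  then show ?case
    by (simp add: fmaj_def maj_def neg_def)
next
  case (Suc m)
  let ?n = "Suc m"
  have "(\<Sum>\<sigma>\<in>signed_perms ?n. x ^ fmaj ?n \<sigma>) =
      (\<Sum>(\<sigma>, k)\<in>signed_perms m \<times> {..<2 * ?n}. x ^ fmaj ?n (letter_shift ?n ^^ k \<circ> \<sigma>))"
    by (subst sum.reindex_bij_betw[OF bij_betw_letter_shift_funpow, symmetric])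
      (simp add: case_prod_unfold)
  also have "\<dots> = (\<Sum>(\<sigma>, k)\<in>signed_perms m \<times> {..<2 * ?n}. x ^ fmaj m \<sigma> * x ^ k)"
  proof (rule sum.cong[OF refl])
    fix z
    assume "z \<in> signed_perms m \<times> {..<2 * ?n}"
    then obtain \<sigma> k where z: "z = (\<sigma>, k)" and \<sigma>: "\<sigma> \<in> signed_perms m" and k: "k \<in> {..<2 * ?n}"
      by blast
    from \<sigma> have "\<sigma> \<in> signed_perms ?n" "\<sigma> (int ?n) = int ?n"
      using signed_perms_fix_iff by blast+
    then have "fmaj ?n (letter_shift ?n ^^ k \<circ> \<sigma>) = fmaj m \<sigma> + k"
      using k fmaj_Suc[OF \<sigma>] fmaj_letter_shift_funpow[of \<sigma> ?n k] by simp
    then show "(case z of (\<sigma>, k) \<Rightarrow> x ^ fmaj ?n (letter_shift ?n ^^ k \<circ> \<sigma>)) =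
        (case z of (\<sigma>, k) \<Rightarrow> x ^ fmaj m \<sigma> * x ^ k)"
      by (simp only: z prod.case power_add)
  qed
  also have "\<dots> = (\<Sum>\<sigma>\<in>signed_perms m. x ^ fmaj m \<sigma>) * (\<Sum>k<2 * ?n. x ^ k)"
    by (simp only: sum_product sum.cartesian_product)
  also have "\<dots> = (\<Prod>i=1..?n. \<Sum>j<2 * i. x ^ j)"
    by (simp only: Suc.IH) simp
  finally show ?case .
qed

theorem theorem6p1:
  fixes n :: nat and q :: "int poly"
  assumes "n \<ge> 1"
  defines "q \<equiv> [:0, 1:]"
  shows "(\<Sum>\<sigma>\<in>signed_perms n. (-1) ^ neg n \<sigma> * q ^ fmaj n \<sigma>) = (\<Prod>i=1..n. q_int (- q) (2 * i))"
proof -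
  have "(-1) ^ neg n \<sigma> * q ^ fmaj n \<sigma> = (- q) ^ fmaj n \<sigma>" for \<sigma>
    by (simp add: fmaj_def power_minus[of q] power_add power_mult)
  \<comment> \<open>This makes \<open>q_int\<close> the geometric sum rather than a division by
    zero.\<close>
  moreover have "- q \<noteq> 1"
    by (simp add: q_def one_pCons)
  ultimately show ?thesis
    by (simp add: sum_power_fmaj q_int_eq_sum)
qed

end
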